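(* Let $\mathbb{F}$ be a field with $\mathrm{char}(\mathbb{F})\neq2$ and $\alpha\in\mathbb{F}\setminus\{0,1,\frac12\}$. Let $E$ be a $2$-dimensional vector space over $\mathbb{F}$ with symmetric bilinear form $b$ and basis $e,f$ satisfying $b(e,e)=b(f,f)=1$, and let $\mu=b(e,f)$. In the split spin factor $A=S(b,\alpha)$ let $x=\frac12(e+\alpha z_1+(\alpha+1)z_2)$ and $y=\frac12(f+\alpha z_1+(\alpha+1)z_2)$, let $D=\langle\tau_x,\tau_y\rangle\leq\mathrm{Aut}(A)$ and $X=x^D\cup y^D$ (union of the $D$-orbits of $x$ and $y$). Let $\zeta$ be an element of an extension field of $\mathbb{F}$ such that $\zeta+\zeta^{-1}=2\mu$. Then: (1) If $\zeta$ is not a root of unity, then $|X|$ is infinite. (2) If $\zeta\neq\pm1$ is of (finite multiplicative) order $n$, then $|X|=n$. (3) Suppose that $\zeta=\pm1$. If $\mathbb{F}$ has characteristic $0$, then $|X|=\infty$; if $\mathbb{F}$ has characteristic $p>0$, then $|X|=p$ if $\zeta=1$ and $|X|=2p$ if $\zeta=-1$.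
   Context: The split spin factor $S(b,\alpha)$ is the commutative (not necessarily associative) algebra on the vector space $E\oplus\mathbb{F}z_1\oplus\mathbb{F}z_2$ with multiplication $z_1^2=z_1$, $z_2^2=z_2$, $z_1z_2=0$, $ez_1=\alpha e$, $ez_2=(1-\alpha)e$, $ef=-b(e,f)z$ for all $e,f\in E$, where $z:=\alpha(\alpha-2)z_1+(\alpha-1)(\alpha+1)z_2$. For $x=\frac12(u+\alpha z_1+(\alpha+1)z_2)$ with $u\in E$, $b(u,u)=1$, the algebra decomposes as the direct sum of the eigenspaces of multiplication by $x$ with eigenvalues $1,0,\alpha,\frac12$, and the Miyamoto involution $\tau_x\in\mathrm{Aut}(A)$ is the linear map acting as $-1$ on the $\frac12$-eigenspace and as identity on the sum of the $1$-, $0$- and $\alpha$-eigenspaces. Explicitly, $\tau_x$ fixes $z_1,z_2$ and acts on $E$ as $-r_u$, i.e. $v\mapsto -v+2b(u,v)u$, where $r_u$ is the reflection in $u$. In the paper $\zeta,\zeta^{-1}$ are the eigenvalues of $\rho=\theta\tau_x$ on $E$, where $\theta$ is the automorphism of $A$ fixing $z_1,z_2$ and swapping $e$ and $f$; this $\rho$ has determinant $1$ and trace $2\mu$ on $E$, so the eigenvalue condition is equivalent to $\zeta+\zeta^{-1}=2\mu$. *)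

theory Defs
  imports
    Complex_Main
    "HOL-Library.Product_Plus"
    "HOL-Algebra.Generated_Groups"
    "HOL-Algebra.Group_Action"
begin

text \<open>
  The space \<open>E\<close> is the whole type \<open>'v\<close>, a vector space over the field \<open>'a\<close> via \<open>scale\<close>.
  The triple \<open>(v, s, t)\<close> stands for the element \<open>v + s z\<^sub>1 + t z\<^sub>2\<close> of the direct sum of \<open>E\<close>
  and the lines spanned by \<open>z\<^sub>1\<close> and \<open>z\<^sub>2\<close>.
\<close>

type_synonym ('v, 'a) ssf = "'v \<times> 'a \<times> 'a"

definition symmetric_bilinear_form ::
    "('a::field \<Rightarrow> 'v::ab_group_add \<Rightarrow> 'v) \<Rightarrow> ('v \<Rightarrow> 'v \<Rightarrow> 'a) \<Rightarrow> bool" where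
  "symmetric_bilinear_form scale b \<longleftrightarrow>
     (\<forall>u v. b u v = b v u) \<and> (\<forall>u. Vector_Spaces.linear scale (*) (b u))"

definition ssf_scale ::
    "('a::field \<Rightarrow> 'v::ab_group_add \<Rightarrow> 'v) \<Rightarrow> 'a \<Rightarrow> ('v, 'a) ssf \<Rightarrow> ('v, 'a) ssf" where
  "ssf_scale scale c = (\<lambda>(v, s, t). (scale c v, c * s, c * t))"

text \<open>
  The bilinear extension of \<open>z\<^sub>1 z\<^sub>1 = z\<^sub>1\<close>, \<open>z\<^sub>2 z\<^sub>2 = z\<^sub>2\<close>, \<open>z\<^sub>1 z\<^sub>2 = 0\<close>, \<open>v z\<^sub>1 = \<alpha> v\<close>,
  \<open>v z\<^sub>2 = (1 - \<alpha>) v\<close> and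
  \<open>v w = - b(v, w) (\<alpha> (\<alpha> - 2) z\<^sub>1 + (\<alpha> - 1) (\<alpha> + 1) z\<^sub>2)\<close> for \<open>v\<close>, \<open>w\<close> in \<open>E\<close>.
\<close>

definition ssf_mult ::
    "('a::field \<Rightarrow> 'v::ab_group_add \<Rightarrow> 'v) \<Rightarrow> ('v \<Rightarrow> 'v \<Rightarrow> 'a) \<Rightarrow> 'a \<Rightarrow>
     ('v, 'a) ssf \<Rightarrow> ('v, 'a) ssf \<Rightarrow> ('v, 'a) ssf" where
  "ssf_mult scale b \<alpha> = (\<lambda>(v, s, t) (w, s', t').
     (scale (\<alpha> * s' + (1 - \<alpha>) * t') v + scale (\<alpha> * s + (1 - \<alpha>) * t) w,
      s * s' - b v w * (\<alpha> * (\<alpha> - 2)),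
      t * t' - b v w * ((\<alpha> - 1) * (\<alpha> + 1))))"

definition ssf_Aut ::
    "('a::field \<Rightarrow> 'v::ab_group_add \<Rightarrow> 'v) \<Rightarrow> ('v \<Rightarrow> 'v \<Rightarrow> 'a) \<Rightarrow> 'a \<Rightarrow>
     (('v, 'a) ssf \<Rightarrow> ('v, 'a) ssf) monoid" where
  "ssf_Aut scale b \<alpha> =
     \<lparr>carrier = {g. bij g \<and> Vector_Spaces.linear (ssf_scale scale) (ssf_scale scale) g \<and>
        (\<forall>p q. g (ssf_mult scale b \<alpha> p q) = ssf_mult scale b \<alpha> (g p) (g q))},
      mult = (\<circ>),
      one = id\<rparr>"

definition ssf_axis :: "('a::field \<Rightarrow> 'v::ab_group_add \<Rightarrow> 'v) \<Rightarrow> 'a \<Rightarrow> 'v \<Rightarrow> ('v, 'a) ssf" where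
  "ssf_axis scale \<alpha> u = ssf_scale scale (1 / 2) (u, \<alpha>, \<alpha> + 1)"

definition ssf_eigenspace ::
    "('a::field \<Rightarrow> 'v::ab_group_add \<Rightarrow> 'v) \<Rightarrow> ('v \<Rightarrow> 'v \<Rightarrow> 'a) \<Rightarrow> 'a \<Rightarrow>
     ('v, 'a) ssf \<Rightarrow> 'a \<Rightarrow> ('v, 'a) ssf set" where
  "ssf_eigenspace scale b \<alpha> a l = {p. ssf_mult scale b \<alpha> a p = ssf_scale scale l p}"

text \<open>
  The description is meaningful only if the algebra is the direct sum of the eigenspaces of \<open>a\<close> for
  \<open>1\<close>, \<open>0\<close>, \<open>\<alpha>\<close> and \<open>1/2\<close>, as is the case for \<open>a = ssf_axis scale \<alpha> u\<close> with \<open>b u u = 1\<close>.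
\<close>

definition miyamoto ::
    "('a::field \<Rightarrow> 'v::ab_group_add \<Rightarrow> 'v) \<Rightarrow> ('v \<Rightarrow> 'v \<Rightarrow> 'a) \<Rightarrow> 'a \<Rightarrow>
     ('v, 'a) ssf \<Rightarrow> ('v, 'a) ssf \<Rightarrow> ('v, 'a) ssf" where
  "miyamoto scale b \<alpha> a =
     (THE g. Vector_Spaces.linear (ssf_scale scale) (ssf_scale scale) g \<and>
        (\<forall>p \<in> ssf_eigenspace scale b \<alpha> a (1 / 2). g p = - p) \<and>
        (\<forall>p \<in> ssf_eigenspace scale b \<alpha> a 1. \<forall>q \<in> ssf_eigenspace scale b \<alpha> a 0.
           \<forall>r \<in> ssf_eigenspace scale b \<alpha> a \<alpha>. g (p + q + r) = p + q + r))"

definition miyamoto_group ::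
    "('a::field \<Rightarrow> 'v::ab_group_add \<Rightarrow> 'v) \<Rightarrow> ('v \<Rightarrow> 'v \<Rightarrow> 'a) \<Rightarrow> 'a \<Rightarrow>
     ('v, 'a) ssf \<Rightarrow> ('v, 'a) ssf \<Rightarrow> (('v, 'a) ssf \<Rightarrow> ('v, 'a) ssf) monoid" where
  "miyamoto_group scale b \<alpha> x y =
     (ssf_Aut scale b \<alpha>)\<lparr>carrier :=
        generate (ssf_Aut scale b \<alpha>) {miyamoto scale b \<alpha> x, miyamoto scale b \<alpha> y}\<rparr>"

definition axis_closure ::
    "('a::field \<Rightarrow> 'v::ab_group_add \<Rightarrow> 'v) \<Rightarrow> ('v \<Rightarrow> 'v \<Rightarrow> 'a) \<Rightarrow> 'a \<Rightarrow>
     ('v, 'a) ssf \<Rightarrow> ('v, 'a) ssf \<Rightarrow> ('v, 'a) ssf set" where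
  "axis_closure scale b \<alpha> x y =
     orbit (miyamoto_group scale b \<alpha> x y) (\<lambda>g. g) x \<union>
     orbit (miyamoto_group scale b \<alpha> x y) (\<lambda>g. g) y"

definition field_embedding :: "('a::field \<Rightarrow> 'k::field) \<Rightarrow> bool" where
  "field_embedding h \<longleftrightarrow>
     h 1 = 1 \<and> (\<forall>c d. h (c + d) = h c + h d) \<and> (\<forall>c d. h (c * d) = h c * h d)"

definition root_of_unity :: "'k::field \<Rightarrow> bool" where
  "root_of_unity \<zeta> \<longleftrightarrow> (\<exists>n>0. \<zeta> ^ n = 1)"

definition has_mult_order :: "'k::field \<Rightarrow> nat \<Rightarrow> bool" where
  "has_mult_order \<zeta> n \<longleftrightarrow> 0 < n \<and> \<zeta> ^ n = 1 \<and> (\<forall>m. 0 < m \<and> m < n \<longrightarrow> \<zeta> ^ m \<noteq> 1)"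

end

theory Submission
  imports Defs
begin

text \<open>
  The Miyamoto involution of an axis \<open>(u + \<alpha> z\<^sub>1 + (\<alpha> + 1) z\<^sub>2) / 2\<close> with \<open>b u u = 1\<close> fixes
  \<open>z\<^sub>1\<close>, \<open>z\<^sub>2\<close> and acts on \<open>E\<close> as \<open>v \<mapsto> 2 b(u, v) u - v\<close> (\<open>miyamoto_axis\<close>). This is read off
  from the eigenspaces: the one for \<open>1/2\<close> is the orthogonal complement of \<open>u\<close> in \<open>E\<close>, the other
  three lie in the span of \<open>u\<close>, \<open>z\<^sub>1\<close>, \<open>z\<^sub>2\<close>, and together they span the algebra.

  Hence the closure of \<open>x\<close> and \<open>y\<close> is in bijection with the orbits of \<open>e\<close> and \<open>f\<close> under the two
  maps on \<open>E\<close>. Let \<open>w\<^sub>0 = e\<close>, \<open>w\<^sub>1 = f\<close> and \<open>w\<^sub>n\<^sub>+\<^sub>1 = 2 \<mu> w\<^sub>n - w\<^sub>n\<^sub>-\<^sub>1\<close> for all integers \<open>n\<close>. The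
  involutions send \<open>w\<^sub>n\<close> to \<open>w\<^sub>-\<^sub>n\<close> and to \<open>w\<^sub>2\<^sub>-\<^sub>n\<close>, so that the two orbits together are exactly the
  set of all \<open>w\<^sub>n\<close> (\<open>axis_closure_eq\<close>).

  It remains to find when \<open>w\<^sub>m = w\<^sub>n\<close>. The coordinates of \<open>w\<^sub>n\<close> are consecutive terms \<open>a\<^sub>n\<close>,
  \<open>- a\<^sub>n\<^sub>-\<^sub>1\<close> of the Lucas sequence with parameter \<open>2 \<mu> = \<zeta> + \<zeta>\<^sup>-\<^sup>1\<close>. If \<open>\<zeta> \<noteq> \<plusminus> 1\<close>, then
  \<open>a\<^sub>n = (\<zeta>\<^sup>n - \<zeta>\<^sup>-\<^sup>n) / (\<zeta> - \<zeta>\<^sup>-\<^sup>1)\<close> in the extension field, and \<open>w\<^sub>m = w\<^sub>n\<close> if and only if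
  \<open>\<zeta>\<^sup>m = \<zeta>\<^sup>n\<close>. If \<open>\<zeta> = \<plusminus> 1\<close>, then \<open>a\<^sub>n = n \<zeta>\<^sup>n\<^sup>-\<^sup>1\<close>, and \<open>w\<^sub>m = w\<^sub>n\<close> if and only if \<open>\<zeta>\<^sup>m = \<zeta>\<^sup>n\<close> and
  \<open>m = n\<close> in the field. In either case \<open>w\<close> is injective on the integers or on the
  integers modulo a period, and that period is the order of \<open>\<zeta>\<close> if \<open>\<zeta> \<noteq> \<plusminus> 1\<close>, the characteristic
  \<open>p\<close> if \<open>\<zeta> = 1\<close>, and \<open>2 p\<close> if \<open>\<zeta> = - 1\<close>, because \<open>p\<close> is odd.
\<close>

section \<open>A linear recurrence indexed by the integers\<close>

text \<open>
  The Lucas sequence \<open>a\<^sub>0 = 0\<close>, \<open>a\<^sub>1 = 1\<close>, \<open>a\<^sub>n\<^sub>+\<^sub>1 = c a\<^sub>n - a\<^sub>n\<^sub>-\<^sub>1\<close>, continued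
  to all integers as an odd function.
\<close>

fun lucas_nat :: "'a::comm_ring_1 \<Rightarrow> nat \<Rightarrow> 'a" where
  "lucas_nat c 0 = 0"
| "lucas_nat c (Suc 0) = 1"
| "lucas_nat c (Suc (Suc n)) = c * lucas_nat c (Suc n) - lucas_nat c n"

definition lucas :: "'a::comm_ring_1 \<Rightarrow> int \<Rightarrow> 'a" where
  "lucas c n = (if 0 \<le> n then lucas_nat c (nat n) else - lucas_nat c (nat (- n)))"

lemma lucas_0 [simp]: "lucas c 0 = 0"
  and lucas_1 [simp]: "lucas c 1 = 1"
  by (simp_all add: lucas_def)

lemma lucas_minus: "lucas c (- n) = - lucas c n"
  by (auto simp: lucas_def)

lemma lucas_rec: "lucas c (n + 1) = c * lucas c n - lucas c (n - 1)"
proof -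
  have pos: "lucas c (int (Suc k) + 1) = c * lucas c (int (Suc k)) - lucas c (int (Suc k) - 1)" for k
    by (simp add: lucas_def nat_add_distrib)
  consider (p) k where "n = int (Suc k)" | (z) "n = 0" | (m) k where "n = - int (Suc k)"
    by (metis int_cases2 not0_implies_Suc of_nat_0 add.inverse_neutral)
  then show ?thesis
  proof cases
    case p
    with pos show ?thesis by simp
  next
    case z
    then show ?thesis by (simp add: lucas_minus)
  next
    case m
    have "lucas c (n + 1) = - lucas c (int (Suc k) - 1)"
      using lucas_minus[of c "int (Suc k) - 1"] unfolding m by simp
    moreover have "lucas c (n - 1) = - lucas c (int (Suc k) + 1)"
      using lucas_minus[of c "int (Suc k) + 1"] unfolding m by (simp add: algebra_simps)
    moreover have "lucas c n = - lucas c (int (Suc k))"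
      using m lucas_minus[of c "int (Suc k)"] by simp
    ultimately show ?thesis
      using pos[of k] by (simp add: algebra_simps)
  qed
qed

lemma lucas_unique:
  assumes "F 0 = 0" "F 1 = 1" "\<And>n. F (n + 1) = c * F n - F (n - 1)"
  shows "F n = lucas c n"
proof -
  have "F n = lucas c n \<and> F (n + 1) = lucas c (n + 1)"
  proof (induction n rule: int_induct[of _ 0])
    case base
    show ?case using assms by simp
  next
    case (step1 i)
    then show ?case
      using assms(3)[of "i + 1"] lucas_rec[of c "i + 1"] by simp
  next
    case (step2 i)
    then show ?case
      using assms(3)[of i] lucas_rec[of c i] by (metis add_diff_cancel_left' diff_diff_eq2 diff_add_cancel)
  qed
  then show ?thesis ..
qed

lemma field_embedding_0: "field_embedding h \<Longrightarrow> h 0 = 0"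
  by (metis add_cancel_right_right add_0 field_embedding_def)

lemma field_embedding_diff: "field_embedding h \<Longrightarrow> h (c - d) = h c - h d"
  by (metis diff_add_cancel add_diff_cancel_right' field_embedding_def)

lemma lucas_hom:
  assumes h: "field_embedding h"
  shows "h (lucas c n) = lucas (h c) n"
proof (rule lucas_unique)
  show "h (lucas c 0) = 0" using field_embedding_0[OF h] by simp
  show "h (lucas c 1) = 1" using h by (simp add: field_embedding_def)
  show "h (lucas c (n + 1)) = h c * h (lucas c n) - h (lucas c (n - 1))" for n
    using h field_embedding_diff[OF h] by (simp add: lucas_rec field_embedding_def)
qed

lemma lucas_geometric:
  fixes z :: "'a::field"
  assumes "z \<noteq> 0" "z \<noteq> inverse z"
  shows "(z - inverse z) * lucas (z + inverse z) n = z powi n - z powi (- n)"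
proof -
  have "(z powi n - z powi (- n)) / (z - inverse z) = lucas (z + inverse z) n"
  proof (rule lucas_unique)
    show "(z powi 1 - z powi (- 1)) / (z - inverse z) = 1"
      using assms by (simp add: power_int_minus)
    fix n :: int
    have "z powi (n + 1) - z powi (- (n + 1)) = (z + inverse z) * (z powi n - z powi (- n))
        - (z powi (n - 1) - z powi (- (n - 1)))"
      using assms(1)
      by (simp add: power_int_add power_int_diff power_int_minus divide_inverse algebra_simps)
    then show "(z powi (n + 1) - z powi (- (n + 1))) / (z - inverse z) =
        (z + inverse z) * ((z powi n - z powi (- n)) / (z - inverse z)) -
        (z powi (n - 1) - z powi (- (n - 1))) / (z - inverse z)"
      by (simp only: diff_divide_distrib times_divide_eq_right right_diff_distrib)
  qed simp
  moreover have "z - inverse z \<noteq> 0" using assms(2) by (simp only: right_minus_eq simp_thms)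
  ultimately show ?thesis by (metis nonzero_mult_div_cancel_left times_divide_eq_right)
qed

text \<open>
  Two consecutive terms determine the power of \<open>z\<close>; a single term does not, since
  \<open>z\<^sup>n - z\<^sup>-\<^sup>n\<close> is unchanged when \<open>z\<^sup>n\<close> is replaced by \<open>- z\<^sup>-\<^sup>n\<close>.
\<close>

lemma lucas_eq_iff_geometric:
  fixes z :: "'a::field"
  assumes "z \<noteq> 0" "z \<noteq> inverse z"
  shows "lucas (z + inverse z) m = lucas (z + inverse z) n \<and>
      lucas (z + inverse z) (m - 1) = lucas (z + inverse z) (n - 1) \<longleftrightarrow> z powi m = z powi n"
    (is "?L m = ?L n \<and> _ \<longleftrightarrow> _")
proof
  assume *: "z powi m = z powi n"
  then have "z powi (m - 1) = z powi (n - 1)"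
    using assms by (simp add: power_int_diff)
  with * have "(z - inverse z) * ?L m = (z - inverse z) * ?L n"
    "(z - inverse z) * ?L (m - 1) = (z - inverse z) * ?L (n - 1)"
    by (simp_all only: lucas_geometric[OF assms] power_int_minus)
  then show "?L m = ?L n \<and> ?L (m - 1) = ?L (n - 1)" using assms by simp
next
  assume *: "?L m = ?L n \<and> ?L (m - 1) = ?L (n - 1)"
  define p where "p = z powi m - z powi n"
  have "z powi m - z powi (- m) = z powi n - z powi (- n)"
    using * lucas_geometric[OF assms] by metis
  then have 1: "p = z powi (- m) - z powi (- n)" by (simp add: p_def algebra_simps)
  have "z powi (m - 1) - z powi (- (m - 1)) = z powi (n - 1) - z powi (- (n - 1))"
    using * lucas_geometric[OF assms] by metis
  moreover have "z powi (k - 1) = z powi k * inverse z" "z powi (- (k - 1)) = z powi (- k) * z" for k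
    using assms by (simp_all add: power_int_diff power_int_minus field_simps)
  ultimately have "z powi m * inverse z - z powi (- m) * z = z powi n * inverse z - z powi (- n) * z"
    by metis
  then have "p * inverse z = (z powi (- m) - z powi (- n)) * z"
    by (simp add: p_def algebra_simps)
  then have "p * (z - inverse z) = 0" by (simp only: 1 [symmetric] right_diff_distrib right_minus_eq)
  moreover have "z - inverse z \<noteq> 0" using assms(2) by (simp only: right_minus_eq simp_thms)
  ultimately have "p = 0" by (simp only: mult_eq_0_iff) blast
  then show "z powi m = z powi n" by (simp add: p_def)
qed

text \<open>
  The degenerate parameters \<open>2\<close> and \<open>- 2\<close>, for which \<open>T\<^sup>2 - c T + 1\<close> has a double root.
\<close>

lemma lucas_unipotent:
  fixes d :: "'a::field"
  assumes "d * d = 1"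
  shows "lucas (2 * d) n = of_int n * d powi (n - 1)"
proof (rule lucas_unique[symmetric])
  have d: "d \<noteq> 0" "inverse d = d" "d\<^sup>2 = 1"
    using assms by (auto intro: inverse_unique simp: power2_eq_square)
  fix n :: int
  have "d powi (n + 1) = d powi n * d" "d powi (n - 1) = d powi n * d"
    "d powi (n - 1 - 1) = d powi n"
    using d by (simp_all add: power_int_add power_int_diff divide_inverse)
  then show "of_int (n + 1) * d powi (n + 1 - 1) =
     2 * d * (of_int n * d powi (n - 1)) - of_int (n - 1) * d powi (n - 1 - 1)"
    using assms by (simp add: algebra_simps)
qed simp_all

lemma lucas_eq_iff_unipotent:
  fixes d :: "'a::field"
  assumes "d * d = 1"
  shows "lucas (2 * d) m = lucas (2 * d) n \<and> lucas (2 * d) (m - 1) = lucas (2 * d) (n - 1) \<longleftrightarrow>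
      d powi m = d powi n \<and> (of_int m :: 'a) = of_int n"
proof -
  have d: "d \<noteq> 0" "inverse d = d" "d\<^sup>2 = 1"
    using assms by (auto intro: inverse_unique simp: power2_eq_square)
  have e: "lucas (2 * d) k = of_int k * d powi k * d"
    "lucas (2 * d) (k - 1) = of_int k * d powi k - d powi k" for k
    unfolding lucas_unipotent[OF assms]
    using d by (simp_all add: power_int_diff divide_inverse left_diff_distrib)
  have "lucas (2 * d) m = lucas (2 * d) n \<and> lucas (2 * d) (m - 1) = lucas (2 * d) (n - 1) \<longleftrightarrow>
      of_int m * d powi m = of_int n * d powi n \<and> d powi m = d powi n"
    unfolding e(2) unfolding e(1) using d by auto
  also have "\<dots> \<longleftrightarrow> d powi m = d powi n \<and> (of_int m :: 'a) = of_int n"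
    using d by auto
  finally show ?thesis .
qed

section \<open>Counting the values of a periodic sequence\<close>

text \<open>The value \<open>N = 0\<close> means that \<open>w\<close> is injective, as only \<open>0\<close> is divisible by \<open>0\<close>.\<close>

lemma range_periodic:
  fixes w :: "int \<Rightarrow> 'b" and N :: nat
  assumes "\<And>m n. w m = w n \<longleftrightarrow> int N dvd m - n"
  shows "N = 0 \<Longrightarrow> infinite (range w)"
    and "N > 0 \<Longrightarrow> finite (range w) \<and> card (range w) = N"
proof -
  assume "N = 0"
  then have "inj w" using assms by (auto simp: inj_def)
  then show "infinite (range w)" using finite_imageD infinite_UNIV_int by blast
next
  assume N: "N > 0"
  have "range w = w ` {0..<int N}"
  proof -
    have "w m = w (m mod int N)" for m using assms[of m "m mod int N"] by simp
    moreover have "m mod int N \<in> {0..<int N}" for m using N by simp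
    ultimately show ?thesis by blast
  qed
  moreover have "inj_on w {0..<int N}"
  proof (rule inj_onI)
    fix m n assume *: "m \<in> {0..<int N}" "n \<in> {0..<int N}" "w m = w n"
    then have "m mod int N = n mod int N" using assms mod_eq_dvd_iff by blast
    with * show "m = n" by simp
  qed
  ultimately show "finite (range w) \<and> card (range w) = N"
    by (simp add: card_image)
qed

lemma powi_eq_iff_not_root_of_unity:
  assumes "z \<noteq> 0" "\<not> root_of_unity z"
  shows "z powi m = z powi n \<longleftrightarrow> m = n"
proof -
  have less: "z powi m \<noteq> z powi n" if "m < n" for m n :: int
  proof
    assume "z powi m = z powi n"
    then have "z powi (n - m) = 1" using assms by (simp add: power_int_diff)
    then have "z ^ nat (n - m) = 1" using that by (simp add: power_int_def)
    moreover have "nat (n - m) > 0" using that by simp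
    ultimately show False using assms(2) by (auto simp only: root_of_unity_def)
  qed
  show ?thesis using less[of m n] less[of n m] by (metis linorder_neqE)
qed

lemma powi_eq_iff_mult_order:
  assumes "z \<noteq> 0" "has_mult_order z N"
  shows "z powi m = z powi n \<longleftrightarrow> int N dvd m - n"
proof -
  have N: "N > 0" "z ^ N = 1" "\<And>k. 0 < k \<Longrightarrow> k < N \<Longrightarrow> z ^ k \<noteq> 1"
    using assms(2) by (auto simp: has_mult_order_def)
  define r where "r = (m - n) mod int N"
  have r: "0 \<le> r" "r < int N" using N(1) by (simp_all add: r_def)
  have "m - n = int N * ((m - n) div int N) + r" by (simp add: r_def)
  then have "z powi (m - n) = z powi (int N * ((m - n) div int N)) * z powi r"
    using assms(1) by (metis power_int_add)
  also have "\<dots> = z powi r"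
    using N(2) by (simp add: power_int_mult)
  finally have "z powi (m - n) = z ^ nat r"
    using r by (simp add: power_int_def)
  moreover have "z powi m = z powi n \<longleftrightarrow> z powi (m - n) = 1"
    using assms(1) by (simp add: power_int_diff)
  moreover have "z ^ nat r = 1 \<longleftrightarrow> r = 0"
    using N(3)[of "nat r"] r by (cases "r = 0") auto
  ultimately show ?thesis by (simp add: r_def dvd_eq_mod_eq_0)
qed

section \<open>The Miyamoto involution of an axis\<close>

text \<open>
  The conditions on \<open>\<alpha>\<close> say that \<open>1\<close>, \<open>0\<close>, \<open>\<alpha>\<close> and \<open>1/2\<close> are distinct. The space \<open>E\<close> is the
  type \<open>'v\<close>, of any dimension.
\<close>

locale split_spin_factor = vector_space scale
  for scale :: "'a::field \<Rightarrow> 'v::ab_group_add \<Rightarrow> 'v" +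
  fixes b :: "'v \<Rightarrow> 'v \<Rightarrow> 'a" and \<alpha> :: 'a
  assumes form: "symmetric_bilinear_form scale b"
    and two_nz: "(2 :: 'a) \<noteq> 0"
    and \<alpha>_generic: "\<alpha> \<noteq> 0" "\<alpha> \<noteq> 1" "2 * \<alpha> \<noteq> 1"
begin

lemma b_sym: "b u v = b v u"
  using form by (auto simp: symmetric_bilinear_form_def)

lemma b_add_right: "b u (v + w) = b u v + b u w"
  and b_scale_right: "b u (scale c v) = c * b u v"
  using form by (auto simp: symmetric_bilinear_form_def Vector_Spaces.linear_iff)

lemma b_add_left: "b (v + w) u = b v u + b w u"
  and b_scale_left: "b (scale c v) u = c * b v u"
  by (metis b_sym b_add_right, metis b_sym b_scale_right)

lemma b_diff_right: "b u (v - w) = b u v - b u w"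
  using b_add_right[of u "v - w" w] by simp

lemma b_diff_left: "b (v - w) u = b v u - b w u"
  by (metis b_sym b_diff_right)

lemmas b_simps = b_add_right b_scale_right b_add_left b_scale_left b_diff_right b_diff_left

lemma vector_space_ssf_scale: "vector_space (ssf_scale scale)"
  by unfold_locales (auto simp: ssf_scale_def algebra_simps)

text \<open>
  The negative of the reflection in a vector \<open>u\<close> with \<open>b u u = 1\<close>, and below its extension to the
  algebra by the identity on \<open>z\<^sub>1\<close> and \<open>z\<^sub>2\<close>.
\<close>

definition flip :: "'v \<Rightarrow> 'v \<Rightarrow> 'v" where
  "flip u v = scale (2 * b u v) u - v"

definition ssf_flip :: "'v \<Rightarrow> ('v, 'a) ssf \<Rightarrow> ('v, 'a) ssf" where
  "ssf_flip u = (\<lambda>(v, s, t). (flip u v, s, t))"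

lemma flip_self: "b u u = 1 \<Longrightarrow> flip u u = u"
  using scale_left_distrib[of 1 1 u] by (simp add: flip_def)

lemma flip_add: "flip u (v + w) = flip u v + flip u w"
  and flip_scale: "flip u (scale c v) = scale c (flip u v)"
  by (simp_all add: flip_def b_simps algebra_simps)

lemma flip_diff: "flip u (v - w) = flip u v - flip u w"
  using flip_add[of u "v - w" w] by simp

lemma flip_flip: "b u u = 1 \<Longrightarrow> flip u (flip u v) = v"
  by (simp add: flip_def b_simps algebra_simps)

lemma b_flip: "b u u = 1 \<Longrightarrow> b (flip u v) (flip u w) = b v w"
  using b_sym[of v u] by (simp add: flip_def b_simps algebra_simps)

lemma linear_ssf_flip:
  "Vector_Spaces.linear (ssf_scale scale) (ssf_scale scale) (ssf_flip u)"
  unfolding Vector_Spaces.linear_iff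
  by (auto simp: vector_space_ssf_scale ssf_flip_def ssf_scale_def flip_add flip_scale)

lemma ssf_flip_flip: "b u u = 1 \<Longrightarrow> ssf_flip u \<circ> ssf_flip u = id"
  by (auto simp: ssf_flip_def flip_flip fun_eq_iff)

lemma ssf_flip_Aut:
  assumes "b u u = 1"
  shows "ssf_flip u \<in> carrier (ssf_Aut scale b \<alpha>)"
proof -
  have "bij (ssf_flip u)"
    using ssf_flip_flip[OF assms] o_bij by blast
  moreover have "ssf_flip u (ssf_mult scale b \<alpha> p q) =
      ssf_mult scale b \<alpha> (ssf_flip u p) (ssf_flip u q)" for p q
    by (cases p; cases q)
      (simp add: ssf_mult_def ssf_flip_def flip_add flip_scale b_flip[OF assms])
  ultimately show ?thesis
    by (simp add: ssf_Aut_def linear_ssf_flip)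
qed

text \<open>The eigenvector equation, multiplied by \<open>2\<close>, in each of the three components.\<close>

lemma eigenspace_axis_iff:
  "(v, s, t) \<in> ssf_eigenspace scale b \<alpha> (ssf_axis scale \<alpha> u) l \<longleftrightarrow>
     scale (\<alpha> * s + (1 - \<alpha>) * t) u = scale (2 * l - 1) v \<and>
     \<alpha> * (s - (\<alpha> - 2) * b u v) = 2 * l * s \<and>
     (\<alpha> + 1) * (t - (\<alpha> - 1) * b u v) = 2 * l * t"
proof -
  have half: "1 / 2 * p = q \<longleftrightarrow> p = 2 * q" for p q :: 'a
    using two_nz by (auto simp: field_simps)
  have half_v: "scale (1 / 2) p = q \<longleftrightarrow> p = scale 2 q" for p q
    using two_nz by auto
  have c: "\<alpha> * (1 / 2 * \<alpha>) + (1 - \<alpha>) * (1 / 2 * (\<alpha> + 1)) = 1 / 2"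
    using two_nz by (simp add: field_simps)
  have "scale (\<alpha> * s + (1 - \<alpha>) * t) (scale (1 / 2) u) + scale (1 / 2) v = scale l v \<longleftrightarrow>
      scale (1 / 2) (scale (\<alpha> * s + (1 - \<alpha>) * t) u + v) = scale l v"
    by (simp add: scale_right_distrib mult.commute)
  also have "\<dots> \<longleftrightarrow> scale (\<alpha> * s + (1 - \<alpha>) * t) u + v = scale 2 (scale l v)"
    by (rule half_v)
  also have "\<dots> \<longleftrightarrow> scale (\<alpha> * s + (1 - \<alpha>) * t) u = scale (2 * l - 1) v"
    by (auto simp: scale_left_diff_distrib algebra_simps)
  finally have E: "scale (\<alpha> * s + (1 - \<alpha>) * t) (scale (1 / 2) u) + scale (1 / 2) v = scale l v \<longleftrightarrow>
      scale (\<alpha> * s + (1 - \<alpha>) * t) u = scale (2 * l - 1) v" .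
  have "1 / 2 * \<alpha> * s - b (scale (1 / 2) u) v * (\<alpha> * (\<alpha> - 2)) =
      1 / 2 * (\<alpha> * (s - (\<alpha> - 2) * b u v))"
    "1 / 2 * (\<alpha> + 1) * t - b (scale (1 / 2) u) v * ((\<alpha> - 1) * (\<alpha> + 1)) =
      1 / 2 * ((\<alpha> + 1) * (t - (\<alpha> - 1) * b u v))"
    by (simp_all add: b_simps right_diff_distrib mult_ac)
  then show ?thesis
    using E c half[of "\<alpha> * (s - (\<alpha> - 2) * b u v)" "l * s"]
      half[of "(\<alpha> + 1) * (t - (\<alpha> - 1) * b u v)" "l * t"]
    by (simp only: ssf_eigenspace_def ssf_axis_def ssf_mult_def ssf_scale_def mem_Collect_eq
        prod.case prod.inject mult.assoc)
qed

lemma half_eigenspace_axis: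
  assumes u: "b u u = 1"
  shows "(v, s, t) \<in> ssf_eigenspace scale b \<alpha> (ssf_axis scale \<alpha> u) (1 / 2) \<longleftrightarrow>
    s = 0 \<and> t = 0 \<and> b u v = 0"
proof
  have h: "2 * (1 / 2 :: 'a) = 1" using two_nz by simp
  have u0: "u \<noteq> 0" using u b_scale_left[of 0 u u] by auto
  define c where "c = b u v"
  assume "(v, s, t) \<in> ssf_eigenspace scale b \<alpha> (ssf_axis scale \<alpha> u) (1 / 2)"
  then have 1: "\<alpha> * s + (1 - \<alpha>) * t = 0"
    and 2: "(1 - \<alpha>) * s = - \<alpha> * (\<alpha> - 2) * c" and 3: "\<alpha> * t = (\<alpha>\<^sup>2 - 1) * c"
    unfolding eigenspace_axis_iff h c_def[symmetric] using u0
    by (simp, simp_all add: algebra_simps power2_eq_square)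
  \<comment> \<open>Eliminating \<open>s\<close> and \<open>t\<close> leaves \<open>c\<close> with a coefficient that vanishes only at \<open>\<alpha> = 1/2\<close>.\<close>
  have "\<alpha> * (1 - \<alpha>) * (\<alpha> * s + (1 - \<alpha>) * t) =
      \<alpha>\<^sup>2 * ((1 - \<alpha>) * s) + (1 - \<alpha>)\<^sup>2 * (\<alpha> * t)"
    by (simp add: algebra_simps power2_eq_square)
  also have "\<dots> = (2 * \<alpha> - 1) * c"
    unfolding 2 3 by (simp add: algebra_simps power2_eq_square)
  finally have c: "c = 0" using 1 \<alpha>_generic by simp
  then show "s = 0 \<and> t = 0 \<and> b u v = 0"
    using 2 3 \<alpha>_generic by (simp add: c_def)
next
  assume "s = 0 \<and> t = 0 \<and> b u v = 0"
  then show "(v, s, t) \<in> ssf_eigenspace scale b \<alpha> (ssf_axis scale \<alpha> u) (1 / 2)"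
    using two_nz by (simp add: eigenspace_axis_iff)
qed

text \<open>Eigenvectors for an eigenvalue other than \<open>1/2\<close> have their component in \<open>E\<close> on the line of \<open>u\<close>.\<close>

lemma flip_other_eigenspace:
  assumes u: "b u u = 1" and l: "2 * l \<noteq> 1"
    and p: "p \<in> ssf_eigenspace scale b \<alpha> (ssf_axis scale \<alpha> u) l"
  shows "ssf_flip u p = p"
proof -
  obtain v s t where p_eq: "p = (v, s, t)" by (cases p)
  have "scale (\<alpha> * s + (1 - \<alpha>) * t) u = scale (2 * l - 1) v"
    using p unfolding p_eq eigenspace_axis_iff by blast
  then have "v = scale ((\<alpha> * s + (1 - \<alpha>) * t) / (2 * l - 1)) u"
    using l by (metis eq_iff_diff_eq_0 scale_left_imp_eq scale_scale nonzero_mult_div_cancel_left times_divide_eq_right)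
  then obtain k where "v = scale k u" by blast
  then have "flip u v = v"
    using u by (simp add: flip_def b_simps scale_left_distrib[symmetric] algebra_simps)
  then show ?thesis by (simp add: p_eq ssf_flip_def)
qed

text \<open>
  Every element of the algebra is a sum of eigenvectors of the axis. On the span of
  \<open>u\<close>, \<open>z\<^sub>1\<close>, \<open>z\<^sub>2\<close> the eigenvectors for \<open>1\<close>, \<open>0\<close>, \<open>\<alpha>\<close> are the multiples of
  \<open>u + \<alpha> z\<^sub>1 + (\<alpha> + 1) z\<^sub>2\<close>, \<open>u + (\<alpha> - 2) z\<^sub>1 + (\<alpha> - 1) z\<^sub>2\<close> and \<open>u + (2 - \<alpha>) z\<^sub>1 - (\<alpha> + 1) z\<^sub>2\<close>.
\<close>

lemma eigen_decomposition:
  assumes u: "b u u = 1"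
  obtains p q r w where
    "p \<in> ssf_eigenspace scale b \<alpha> (ssf_axis scale \<alpha> u) 1"
    "q \<in> ssf_eigenspace scale b \<alpha> (ssf_axis scale \<alpha> u) 0"
    "r \<in> ssf_eigenspace scale b \<alpha> (ssf_axis scale \<alpha> u) \<alpha>"
    "w \<in> ssf_eigenspace scale b \<alpha> (ssf_axis scale \<alpha> u) (1 / 2)"
    "a = (p + q + r) + w"
proof -
  obtain v s t where a: "a = (v, s, t)" by (cases a)
  \<comment> \<open>\<open>A\<close>, \<open>B\<close>, \<open>C\<close> solve the linear system for the coefficients of these three eigenvectors; its
      determinant is a power of \<open>2\<close> up to sign.\<close>
  define c where "c = b u v"
  define C where "C = (c - t + s) / (2 * 2)"
  define B where "B = (\<alpha> * c + (2 - 2 * \<alpha>) * C - s) / 2"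
  define A where "A = c - B - C"
  have "(2 * 2 :: 'a) \<noteq> 0" using two_nz by (metis mult_eq_0_iff)
  then have C: "2 * 2 * C = c - t + s" unfolding C_def by (metis nonzero_mult_div_cancel_left times_divide_eq_right)
  have B: "2 * B = \<alpha> * c + (2 - 2 * \<alpha>) * C - s" using two_nz by (simp add: B_def)
  have s: "A * \<alpha> + B * (\<alpha> - 2) + C * (2 - \<alpha>) = s"
    using B by (simp add: A_def algebra_simps)
  have t: "A * (\<alpha> + 1) + B * (\<alpha> - 1) + C * (- (\<alpha> + 1)) = t"
  proof -
    have "A * (\<alpha> + 1) + B * (\<alpha> - 1) + C * (- (\<alpha> + 1)) = (\<alpha> + 1) * c - 2 * B - 2 * (\<alpha> + 1) * C"
      by (simp add: A_def algebra_simps)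
    also have "\<dots> = c + s - 2 * 2 * C" unfolding B by (simp add: algebra_simps)
    also have "\<dots> = t" unfolding C by simp
    finally show ?thesis .
  qed
  have c: "A + B + C = c" by (simp add: A_def)
  show thesis
  proof
    show "(scale A u, A * \<alpha>, A * (\<alpha> + 1)) \<in> ssf_eigenspace scale b \<alpha> (ssf_axis scale \<alpha> u) 1"
      "(scale B u, B * (\<alpha> - 2), B * (\<alpha> - 1)) \<in> ssf_eigenspace scale b \<alpha> (ssf_axis scale \<alpha> u) 0"
      "(scale C u, C * (2 - \<alpha>), C * (- (\<alpha> + 1))) \<in> ssf_eigenspace scale b \<alpha> (ssf_axis scale \<alpha> u) \<alpha>"
      unfolding eigenspace_axis_iff using u by (simp_all add: b_simps algebra_simps)
    show "(v - scale c u, 0, 0) \<in> ssf_eigenspace scale b \<alpha> (ssf_axis scale \<alpha> u) (1 / 2)"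
      unfolding half_eigenspace_axis[OF u] using u by (simp add: b_simps c_def)
    show "a = ((scale A u, A * \<alpha>, A * (\<alpha> + 1)) + (scale B u, B * (\<alpha> - 2), B * (\<alpha> - 1)) +
        (scale C u, C * (2 - \<alpha>), C * (- (\<alpha> + 1)))) + (v - scale c u, 0, 0)"
      using s t by (simp add: a c[symmetric] scale_left_distrib)
  qed
qed

lemma miyamoto_axis:
  assumes u: "b u u = 1"
  shows "miyamoto scale b \<alpha> (ssf_axis scale \<alpha> u) = ssf_flip u"
  unfolding miyamoto_def
proof (rule the_equality, intro conjI ballI)
  let ?V = "ssf_eigenspace scale b \<alpha> (ssf_axis scale \<alpha> u)"
  show lin: "Vector_Spaces.linear (ssf_scale scale) (ssf_scale scale) (ssf_flip u)"
    by (rule linear_ssf_flip)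
  show neg: "ssf_flip u p = - p" if "p \<in> ?V (1 / 2)" for p
    using that half_eigenspace_axis[OF u]
    by (cases p) (auto simp: ssf_flip_def flip_def)
  have add: "ssf_flip u (p + q) = ssf_flip u p + ssf_flip u q" for p q
    using lin unfolding Vector_Spaces.linear_iff by blast
  have two_ne_1: "(2 :: 'a) \<noteq> 1"
    by (metis add_cancel_right_right one_add_one zero_neq_one)
  show fix_sum: "ssf_flip u (p + q + r) = p + q + r" if "p \<in> ?V 1" "q \<in> ?V 0" "r \<in> ?V \<alpha>" for p q r
    using flip_other_eigenspace[OF u, of 1 p] flip_other_eigenspace[OF u, of 0 q]
      flip_other_eigenspace[OF u, of \<alpha> r] that \<alpha>_generic add two_ne_1 by simp
  fix g
  assume g: "Vector_Spaces.linear (ssf_scale scale) (ssf_scale scale) g \<and>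
    (\<forall>p \<in> ?V (1 / 2). g p = - p) \<and>
    (\<forall>p \<in> ?V 1. \<forall>q \<in> ?V 0. \<forall>r \<in> ?V \<alpha>. g (p + q + r) = p + q + r)"
  have g_add: "g (p + q) = g p + g q" for p q
    using g unfolding Vector_Spaces.linear_iff by blast
  show "g = ssf_flip u"
  proof
    fix a
    obtain p q r w where "p \<in> ?V 1" "q \<in> ?V 0" "r \<in> ?V \<alpha>" "w \<in> ?V (1 / 2)" "a = (p + q + r) + w"
      using eigen_decomposition[OF u] by blast
    then show "g a = ssf_flip u a"
      using g fix_sum neg by (simp only: g_add[of "p + q + r"] add[of "p + q + r"])
  qed
qed

lemma inv_ssf_flip:
  assumes "b u u = 1"
  shows "inv\<^bsub>ssf_Aut scale b \<alpha>\<^esub> (ssf_flip u) = ssf_flip u"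
proof -
  have "g = ssf_flip u" if "g \<circ> ssf_flip u = id" for g
    by (metis that assms ssf_flip_flip comp_assoc comp_id id_comp)
  then show ?thesis
    unfolding m_inv_def using ssf_flip_Aut[OF assms] ssf_flip_flip[OF assms]
    by (intro the_equality) (auto simp: ssf_Aut_def)
qed

section \<open>The closure of two axes\<close>

text \<open>
  The vectors underlying the closure, in the order in which the rotation
  \<open>e \<mapsto> f \<mapsto> 2 b(e, f) f - e\<close> visits them, with \<open>e\<close> at index \<open>0\<close> and \<open>f\<close> at index \<open>1\<close>.
\<close>

definition dihedral_seq :: "'v \<Rightarrow> 'v \<Rightarrow> int \<Rightarrow> 'v" where
  "dihedral_seq e f n = scale (lucas (2 * b e f) n) f - scale (lucas (2 * b e f) (n - 1)) e"

lemma dihedral_seq_0: "dihedral_seq e f 0 = e"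
  using lucas_minus[of "2 * b e f" 1] by (simp add: dihedral_seq_def)

lemma dihedral_seq_1: "dihedral_seq e f 1 = f"
  by (simp add: dihedral_seq_def)

lemma flip_dihedral_seq_left:
  assumes e: "b e e = 1"
  shows "flip e (dihedral_seq e f n) = dihedral_seq e f (- n)"
proof -
  let ?a = "lucas (2 * b e f)"
  have fe: "flip e e = e" using e by (rule flip_self)
  have ff: "flip e f = scale (2 * b e f) e - f" by (simp add: flip_def)
  have "flip e (dihedral_seq e f n) = scale (2 * b e f * ?a n - ?a (n - 1)) e - scale (?a n) f"
    unfolding dihedral_seq_def flip_diff flip_scale fe ff
    by (simp add: algebra_simps)
  also have "2 * b e f * ?a n - ?a (n - 1) = - ?a (- n - 1)"
    using lucas_rec[of "2 * b e f" n] lucas_minus[of "2 * b e f" "n + 1"] by simp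
  finally show ?thesis
    by (simp add: dihedral_seq_def lucas_minus)
qed

lemma flip_dihedral_seq_right:
  assumes f: "b f f = 1"
  shows "flip f (dihedral_seq e f n) = dihedral_seq e f (2 - n)"
proof -
  let ?a = "lucas (2 * b e f)"
  have ff: "flip f f = f" using f by (rule flip_self)
  have fe: "flip f e = scale (2 * b e f) f - e" using b_sym[of e f] by (simp add: flip_def)
  have "flip f (dihedral_seq e f n) = scale (?a n - 2 * b e f * ?a (n - 1)) f + scale (?a (n - 1)) e"
    unfolding dihedral_seq_def flip_diff flip_scale fe ff
    by (simp add: algebra_simps)
  also have "?a n - 2 * b e f * ?a (n - 1) = ?a (2 - n)"
    using lucas_rec[of "2 * b e f" "n - 1"] lucas_minus[of "2 * b e f" "n - 2"] by simp
  also have "?a (n - 1) = - ?a (2 - n - 1)"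
    using lucas_minus[of "2 * b e f" "n - 1"] by simp
  finally show ?thesis
    by (simp add: dihedral_seq_def)
qed

lemma ssf_flip_axis: "ssf_flip u (ssf_axis scale \<alpha> v) = ssf_axis scale \<alpha> (flip u v)"
  by (simp add: ssf_flip_def ssf_axis_def ssf_scale_def flip_scale)

lemma inj_axis: "inj (ssf_axis scale \<alpha>)"
  using two_nz by (auto simp: inj_def ssf_axis_def ssf_scale_def)

lemma axis_closure_eq:
  assumes e: "b e e = 1" and f: "b f f = 1"
  shows "axis_closure scale b \<alpha> (ssf_axis scale \<alpha> e) (ssf_axis scale \<alpha> f) =
    ssf_axis scale \<alpha> ` range (dihedral_seq e f)"
proof -
  let ?G = "ssf_Aut scale b \<alpha>"
  let ?D = "generate ?G {ssf_flip e, ssf_flip f}"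
  let ?w = "\<lambda>n. ssf_axis scale \<alpha> (dihedral_seq e f n)"
  have closure: "axis_closure scale b \<alpha> (ssf_axis scale \<alpha> e) (ssf_axis scale \<alpha> f) =
      {g (?w 0) | g. g \<in> ?D} \<union> {g (?w 1) | g. g \<in> ?D}"
    by (simp add: axis_closure_def orbit_def miyamoto_group_def miyamoto_axis e f
        dihedral_seq_0 dihedral_seq_1)
  have we: "ssf_flip e (?w n) = ?w (- n)" and wf: "ssf_flip f (?w n) = ?w (2 - n)" for n
    by (simp_all add: ssf_flip_axis flip_dihedral_seq_left[OF e] flip_dihedral_seq_right[OF f])
  have stable: "\<forall>n. g (?w n) \<in> range ?w" if "g \<in> ?D" for g
    using that
  proof (induction rule: generate.induct)
    case one
    then show ?case by (simp add: ssf_Aut_def)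
  next
    case (incl h)
    then show ?case using we wf by auto
  next
    case (inv h)
    then show ?case using we wf inv_ssf_flip e f by auto
  next
    case (eng h1 h2)
    show ?case
    proof
      fix n
      obtain m where "h2 (?w n) = ?w m" using eng.IH(2) by auto
      then show "(h1 \<otimes>\<^bsub>?G\<^esub> h2) (?w n) \<in> range ?w"
        using eng.IH(1) by (simp add: ssf_Aut_def)
    qed
  qed
  have flips: "ssf_flip e \<in> ?D" "ssf_flip f \<in> ?D" by (auto intro: generate.incl)
  have comp: "g \<circ> g' \<in> ?D" if "g \<in> ?D" "g' \<in> ?D" for g g'
    using generate.eng[OF that] by (simp add: ssf_Aut_def)
  have id: "id \<in> ?D" using generate.one[of ?G] by (simp add: ssf_Aut_def)
  \<comment> \<open>The product of the two involutions shifts indices by two, so the orbits of \<open>e\<close> and \<open>f\<close>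
      contain the terms of even and of odd index.\<close>
  have reach: "\<exists>g\<in>?D. g (?w r) = ?w (r + 2 * k)" for r k
  proof (induction k rule: int_induct[of _ 0])
    case base
    show ?case using id by (intro bexI[of _ id]) auto
  next
    case (step1 i)
    then obtain g where "g \<in> ?D" "g (?w r) = ?w (r + 2 * i)" by blast
    then show ?case using we wf
      by (intro bexI[of _ "ssf_flip f \<circ> (ssf_flip e \<circ> g)"])
        (auto intro: comp flips simp: algebra_simps)
  next
    case (step2 i)
    then obtain g where "g \<in> ?D" "g (?w r) = ?w (r + 2 * i)" by blast
    then show ?case using we wf
      by (intro bexI[of _ "ssf_flip e \<circ> (ssf_flip f \<circ> g)"])
        (auto intro: comp flips simp: algebra_simps)
  qed
  have "?w n \<in> {g (?w 0) | g. g \<in> ?D} \<union> {g (?w 1) | g. g \<in> ?D}" for n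
  proof (cases "even n")
    case True
    then have "n = 0 + 2 * (n div 2)" by simp
    then show ?thesis using reach[of 0 "n div 2"] by fastforce
  next
    case False
    then have "n = 1 + 2 * (n div 2)" by presburger
    then show ?thesis using reach[of 1 "n div 2"] by fastforce
  qed
  then have "{g (?w 0) | g. g \<in> ?D} \<union> {g (?w 1) | g. g \<in> ?D} = range ?w"
    using stable by blast
  then show ?thesis by (simp add: closure image_image)
qed

lemma dihedral_seq_eq_iff:
  assumes ind: "e \<noteq> f" "independent {e, f}"
  shows "dihedral_seq e f m = dihedral_seq e f n \<longleftrightarrow>
    lucas (2 * b e f) m = lucas (2 * b e f) n \<and>
    lucas (2 * b e f) (m - 1) = lucas (2 * b e f) (n - 1)"
proof
  let ?a = "lucas (2 * b e f)"
  \<comment> \<open>The coefficients of \<open>dihedral_seq e f m - dihedral_seq e f n\<close> at \<open>e\<close> and \<open>f\<close>.\<close>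
  let ?k = "\<lambda>v. if v = e then ?a (n - 1) - ?a (m - 1) else ?a m - ?a n"
  assume "dihedral_seq e f m = dihedral_seq e f n"
  then have "(\<Sum>v\<in>{e, f}. scale (?k v) v) = 0"
    using ind(1) by (simp add: dihedral_seq_def algebra_simps)
  then have "?k v = 0" if "v \<in> {e, f}" for v
    using independentD[OF ind(2) _ order_refl _ that, of ?k] by simp
  from this[of e] this[of f] show "?a m = ?a n \<and> ?a (m - 1) = ?a (n - 1)"
    using ind(1) by simp
qed (simp add: dihedral_seq_def)

end

lemma double_dvd_iff:
  assumes "odd p"
  shows "int (2 * p) dvd k \<longleftrightarrow> 2 dvd k \<and> int p dvd k"
proof -
  have "coprime 2 (int p)" using assms by simp
  then show ?thesis
    by (metis divides_mult dvd_mult_left dvd_mult_right of_nat_mult of_nat_numeral)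
qed

theorem lemma5p3:
  fixes scale :: "'a::field \<Rightarrow> 'v::ab_group_add \<Rightarrow> 'v"
    and b :: "'v \<Rightarrow> 'v \<Rightarrow> 'a"
    and \<alpha> \<mu> :: 'a
    and e f :: 'v
    and x y :: "('v, 'a) ssf"
    and X :: "('v, 'a) ssf set"
    and h :: "'a \<Rightarrow> 'k::field"
    and \<zeta> :: 'k
  assumes "CHAR('a) \<noteq> 2"
    and "\<alpha> \<notin> {0, 1, 1 / 2}"
    and "vector_space scale"
    and "e \<noteq> f" and "\<not> module.dependent scale {e, f}" and "module.span scale {e, f} = UNIV"
    and "symmetric_bilinear_form scale b"
    and "b e e = 1" and "b f f = 1"
    and "\<mu> = b e f"
    and "x = ssf_axis scale \<alpha> e" and "y = ssf_axis scale \<alpha> f"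
    and "X = axis_closure scale b \<alpha> x y"
    and "field_embedding h"
    and "\<zeta> \<noteq> 0" and "\<zeta> + inverse \<zeta> = 2 * h \<mu>"
  shows "(\<not> root_of_unity \<zeta> \<longrightarrow> infinite X) \<and>
    (\<forall>n. \<zeta> \<noteq> 1 \<and> \<zeta> \<noteq> - 1 \<and> has_mult_order \<zeta> n \<longrightarrow> finite X \<and> card X = n) \<and>
    (\<zeta> = 1 \<or> \<zeta> = - 1 \<longrightarrow>
      (CHAR('a) = 0 \<longrightarrow> infinite X) \<and>
      (\<forall>p. CHAR('a) = p \<and> p > 0 \<longrightarrow>
        (\<zeta> = 1 \<longrightarrow> finite X \<and> card X = p) \<and>
        (\<zeta> = - 1 \<longrightarrow> finite X \<and> card X = 2 * p)))"
proof -
  have "\<not> CHAR('a) dvd 2"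
  proof
    assume "CHAR('a) dvd 2"
    then have "CHAR('a) \<le> 2" "CHAR('a) \<noteq> 0" by (auto dest: dvd_imp_le intro: ccontr)
    moreover have "CHAR('a) \<noteq> 1" using CHAR_not_1'[where ?'a = 'a] by simp
    ultimately show False using assms(1) by linarith
  qed
  then have two: "(2 :: 'a) \<noteq> 0"
    using of_nat_eq_0_iff_char_dvd[of 2, where ?'a = 'a] by simp
  have "2 * \<alpha> \<noteq> 1" using assms(2) two by (auto simp: eq_divide_eq mult.commute)
  then interpret split_spin_factor scale b \<alpha>
    using assms two by (simp add: split_spin_factor_def split_spin_factor_axioms_def)
  let ?w = "dihedral_seq e f"
  have X: "X = ssf_axis scale \<alpha> ` range ?w"
    using assms axis_closure_eq by simp
  have inj: "inj_on (ssf_axis scale \<alpha>) S" for S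
    using inj_axis inj_on_subset by blast
  have infinite_X: "infinite X" if "\<And>m n. ?w m = ?w n \<longleftrightarrow> m = n"
    using range_periodic(1)[of ?w 0] that by (simp add: X finite_image_iff[OF inj])
  have card_X: "finite X \<and> card X = N" if "\<And>m n. ?w m = ?w n \<longleftrightarrow> int N dvd m - n" "N > 0" for N
    using range_periodic(2)[of ?w N] that by (simp add: X card_image[OF inj])

  have h1: "h 1 = 1" and h_add: "h (c + d) = h c + h d" and h_mult: "h (c * d) = h c * h d" for c d
    using assms(14) by (auto simp: field_embedding_def)
  note h0 = field_embedding_0[OF assms(14)] and h_diff = field_embedding_diff[OF assms(14)]
  have h_inj: "h c = h d \<longleftrightarrow> c = d" for c d
  proof
    assume "h c = h d"
    then have "h (c - d) = 0" by (simp add: h_diff)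
    then have "h ((c - d) * inverse (c - d)) = 0" by (simp add: h_mult)
    then show "c = d" using h1 by (cases "c = d") auto
  qed simp
  have h2: "h (2 * c) = 2 * h c" for c
    using h_add[of c c] by (simp only: mult_2)
  have w_eq: "?w m = ?w n \<longleftrightarrow> lucas (2 * \<mu>) m = lucas (2 * \<mu>) n \<and>
      lucas (2 * \<mu>) (m - 1) = lucas (2 * \<mu>) (n - 1)" for m n
    using dihedral_seq_eq_iff[OF assms(4,5)] assms(10) by simp
  have geometric: "?w m = ?w n \<longleftrightarrow> \<zeta> powi m = \<zeta> powi n" if "\<zeta> \<noteq> 1" "\<zeta> \<noteq> - 1" for m n
  proof -
    have "(\<zeta> - 1) * (\<zeta> + 1) \<noteq> 0" using that by (auto simp: add_eq_0_iff2)
    then have "\<zeta> * \<zeta> \<noteq> 1" by (simp add: algebra_simps)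
    then have ne: "\<zeta> \<noteq> inverse \<zeta>" using assms(15) by (metis right_inverse)
    have "lucas (2 * \<mu>) i = lucas (2 * \<mu>) j \<longleftrightarrow>
        lucas (\<zeta> + inverse \<zeta>) i = lucas (\<zeta> + inverse \<zeta>) j" for i j
      using lucas_hom[OF assms(14), of "2 * \<mu>"] h_inj by (metis h2 assms(16))
    then show ?thesis
      using w_eq lucas_eq_iff_geometric[OF assms(15) ne] by simp
  qed
  have unipotent: "?w m = ?w n \<longleftrightarrow> d powi m = d powi n \<and> int CHAR('a) dvd m - n"
    if "d * d = 1" "\<mu> = d" for m n d
    using w_eq[of m n] lucas_eq_iff_unipotent[OF that(1), of m n] that(2)
      of_int_eq_0_iff_char_dvd[of "m - n", where ?'a = 'a] by simp
  have two_k: "(2 :: 'k) \<noteq> 0"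
    using h_inj[of 2 0] h2[of 1] two h0 h1 by simp
  have \<mu>_1: "\<mu> = 1" if "\<zeta> = 1"
  proof -
    have "2 * h \<mu> = 2 * h 1" using assms(16) that h1 by simp
    then show ?thesis using two_k h_inj by simp
  qed
  have \<mu>_m1: "\<mu> = - 1" if "\<zeta> = - 1"
  proof -
    have "2 * h \<mu> = 2 * h (- 1)" using assms(16) that h1 h_diff[of 0 1] h0 by simp
    then show ?thesis using two_k h_inj by simp
  qed
  have "- 1 \<noteq> (1 :: 'a)" using two by (metis add.inverse_inverse add_eq_0_iff one_add_one)
  then have sign: "(- 1 :: 'a) powi m = (- 1) powi n \<longleftrightarrow> 2 dvd m - n" for m n
    by (auto simp: power_int_minus_left)
  have eq_1: "?w m = ?w n \<longleftrightarrow> int CHAR('a) dvd m - n" if "\<zeta> = 1" for m n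
    using unipotent[of 1] \<mu>_1[OF that] by simp
  have eq_m1: "?w m = ?w n \<longleftrightarrow> 2 dvd m - n \<and> int CHAR('a) dvd m - n" if "\<zeta> = - 1" for m n
    using unipotent[of "- 1"] \<mu>_m1[OF that] sign by simp

  show ?thesis
  proof (intro conjI allI impI)
    assume not_root: "\<not> root_of_unity \<zeta>"
    have "root_of_unity (1 :: 'k)" "root_of_unity (- 1 :: 'k)"
      unfolding root_of_unity_def by (auto intro: exI[of _ 1] exI[of _ 2])
    with not_root have "\<zeta> \<noteq> 1" "\<zeta> \<noteq> - 1" by auto
    then show "infinite X"
      using infinite_X geometric powi_eq_iff_not_root_of_unity[OF assms(15) not_root] by simp
  next
    fix n
    assume n: "\<zeta> \<noteq> 1 \<and> \<zeta> \<noteq> - 1 \<and> has_mult_order \<zeta> n"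
    then have "finite X \<and> card X = n"
      using card_X[of n] geometric powi_eq_iff_mult_order[OF assms(15)]
      by (simp add: has_mult_order_def)
    then show "finite X" "card X = n" by auto
  next
    assume "\<zeta> = 1 \<or> \<zeta> = - 1" "CHAR('a) = 0"
    then show "infinite X"
      using infinite_X eq_1 eq_m1 by auto
  next
    fix p
    assume p: "CHAR('a) = p \<and> p > 0" and "\<zeta> = 1"
    then have "finite X \<and> card X = p" using card_X[of p] eq_1 by simp
    then show "finite X" "card X = p" by auto
  next
    fix p
    assume p: "CHAR('a) = p \<and> p > 0" and \<zeta>: "\<zeta> = - 1"
    \<comment> \<open>If \<open>p = 2 k\<close>, then \<open>2 \<noteq> 0\<close> forces \<open>k = 0\<close> in the field, against the minimality of \<open>p\<close>.\<close>
    have "odd p"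
    proof
      assume "even p"
      then obtain k where k: "p = 2 * k" by blast
      have "(2 :: 'a) * of_nat k = of_nat p" by (simp add: k)
      also have "\<dots> = 0" using p of_nat_CHAR[where ?'a = 'a] by simp
      finally have "p dvd k" using two p of_nat_eq_0_iff_char_dvd[of k, where ?'a = 'a] by simp
      then show False using p k by (auto dest: dvd_imp_le)
    qed
    then have "finite X \<and> card X = 2 * p"
      using card_X[of "2 * p"] eq_m1[OF \<zeta>] p double_dvd_iff[of p] by simp
    then show "finite X" "card X = 2 * p" by auto
  qed
qed

end
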